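(* Let $n\ge2$, let $q$ be a prime power and $\mathbb{V}_0=\mathbb{F}_q^n$. Let $M\in E_n(\mathbb{F}_q)$ be a non-scalar matrix. Then $t(\langle M\rangle)$ is a nontrivial twin class in $\mathbf{SIG}(\mathbb{V}_0)$. More precisely, for every non-zero scalar $c\in\mathbb{F}_q$, if $N=M+cI_n$, then $t(\langle N\rangle)=t(\langle M\rangle)$.
   Context: $\mathbb{F}_q$ is the finite field with $q$ elements and $\mathbb{V}_0=\mathbb{F}_q^n$ is the space of column vectors. $E_n(\mathbb{F}_q)$ is the set of nonzero matrices $M\in M_n(\mathbb{F}_q)$ having at least one eigenvector in $\mathbb{V}_0$ (a nonzero $v$ with $Mv=\lambda v$ for some $\lambda\in\mathbb{F}_q$; $\lambda=0$ allowed). $\mathcal{E}^{n-1}(\mathbb{F}_q)=\{\langle M\rangle: M\in E_n(\mathbb{F}_q)\}$ is the set of one-dimensional subspaces of $M_n(\mathbb{F}_q)$ generated by elements of $E_n(\mathbb{F}_q)$, and $\mathbb{P}^{n-1}(\mathbb{F}_q)$ is the set of one-dimensional subspaces $\langle v\rangle$ of $\mathbb{V}_0$. The spectral incidence graph $\mathbf{SIG}(\mathbb{V}_0)$ is the simple bipartite graph with vertex set the disjoint union $\mathcal{E}^{n-1}(\mathbb{F}_q)\cup\mathbb{P}^{n-1}(\mathbb{F}_q)$ in which $\langle M\rangle$ and $\langle v\rangle$ are adjacent iff $v$ is an eigenvector of $M$. The twin class of a vertex $x$ is $t(x)=\{y: N(y)=N(x)\}$, where $N(\cdot)$ denotes the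 set of neighbours; it is nontrivial if $t(x)\ne\{x\}$. A scalar matrix is one of the form $\lambda I_n$. *)

theory Defs
  imports "Jordan_Normal_Form.Char_Poly"
begin

(* Simple undirected graphs: an edge is an unordered pair of distinct vertices. *)

record 'v graph =
  vertices :: "'v set"
  edges :: "'v set set"

definition simple_graph :: "'v graph \<Rightarrow> bool" where
  "simple_graph G \<longleftrightarrow>
     (\<forall>e\<in>edges G. \<exists>x\<in>vertices G. \<exists>y\<in>vertices G. x \<noteq> y \<and> e = {x, y})"

definition neighbours :: "'v graph \<Rightarrow> 'v \<Rightarrow> 'v set" where
  "neighbours G x = {y \<in> vertices G. {x, y} \<in> edges G}"

definition twin_class :: "'v graph \<Rightarrow> 'v \<Rightarrow> 'v set" where
  "twin_class G x = {y \<in> vertices G. neighbours G y = neighbours G x}"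

(* The field with q elements is a type 'a of class {field, finite} with CARD('a) = q. *)

definition spec_mats :: "nat \<Rightarrow> 'a :: {field, finite} mat set" where
  "spec_mats n = {M \<in> carrier_mat n n. M \<noteq> 0\<^sub>m n n \<and> (\<exists>v k. eigenvector M v k)}"

definition mat_line :: "'a :: {field, finite} mat \<Rightarrow> 'a mat set" where
  "mat_line M = {c \<cdot>\<^sub>m M | c. True}"

definition vec_line :: "'a :: {field, finite} vec \<Rightarrow> 'a vec set" where
  "vec_line v = {c \<cdot>\<^sub>v v | c. True}"

definition spec_points :: "nat \<Rightarrow> 'a :: {field, finite} mat set set" where
  "spec_points n = mat_line ` spec_mats n"

definition proj_points :: "nat \<Rightarrow> 'a :: {field, finite} vec set set" where
  "proj_points n = vec_line ` (carrier_vec n - {0\<^sub>v n})"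

(* Adjacency is stated through representatives; by SIG_edge_iff below it does not
   depend on their choice. *)

definition SIG :: "nat \<Rightarrow> ('a :: {field, finite} mat set + 'a vec set) graph" where
  "SIG n = \<lparr>vertices = spec_points n <+> proj_points n,
            edges = {{Inl (mat_line M), Inr (vec_line v)} | M v.
                      M \<in> spec_mats n \<and> (\<exists>k. eigenvector M v k)}\<rparr>"

definition scalar_mat :: "nat \<Rightarrow> 'a :: {field, finite} mat \<Rightarrow> bool" where
  "scalar_mat n M \<longleftrightarrow> (\<exists>c. M = c \<cdot>\<^sub>m 1\<^sub>m n)"

lemma simple_graph_SIG: "simple_graph (SIG n)"
  unfolding simple_graph_def SIG_def
proof (simp, intro allI impI, elim exE conjE)
  fix e and M :: "'a mat" and v k
  assume e: "e = {Inl (mat_line M), Inr (vec_line v)}"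
    and M: "M \<in> spec_mats n" and v: "eigenvector M v k"
  from M have "Inl (mat_line M) \<in> spec_points n <+> proj_points n"
    by (auto simp: spec_points_def)
  moreover from M v have "Inr (vec_line v) \<in> spec_points n <+> proj_points n"
    by (auto simp: proj_points_def spec_mats_def eigenvector_def)
  ultimately show "\<exists>x\<in>spec_points n <+> proj_points n.
      \<exists>y\<in>spec_points n <+> proj_points n. x \<noteq> y \<and> e = {x, y}"
    using e by blast
qed

lemma SIG_edge_iff:
  fixes M :: "'a :: {field, finite} mat"
  assumes M: "M \<in> spec_mats n" and v: "v \<in> carrier_vec n" "v \<noteq> 0\<^sub>v n"
  shows "{Inl (mat_line M), Inr (vec_line v)} \<in> edges (SIG n) \<longleftrightarrow> (\<exists>k. eigenvector M v k)"
proof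
  assume "\<exists>k. eigenvector M v k"
  then show "{Inl (mat_line M), Inr (vec_line v)} \<in> edges (SIG n)"
    using M by (auto simp: SIG_def)
next
  assume "{Inl (mat_line M), Inr (vec_line v)} \<in> edges (SIG n)"
  then obtain M' v' k where M': "M' \<in> spec_mats n" and ev: "eigenvector M' v' k"
    and eq: "mat_line M = mat_line M'" "vec_line v = vec_line v'"
    by (auto simp: SIG_def doubleton_eq_iff)
  have "M = 1 \<cdot>\<^sub>m M" by auto
  then have "M \<in> mat_line M" unfolding mat_line_def by blast
  then have "M \<in> mat_line M'" unfolding eq(1) .
  then obtain a where a: "M = a \<cdot>\<^sub>m M'" by (auto simp: mat_line_def)
  have "v = 1 \<cdot>\<^sub>v v" by auto
  then have "v \<in> vec_line v" unfolding vec_line_def by blast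
  then have "v \<in> vec_line v'" unfolding eq(2) .
  then obtain b where b: "v = b \<cdot>\<^sub>v v'" by (auto simp: vec_line_def)
  have c: "M' \<in> carrier_mat n n" "v' \<in> carrier_vec n" "M' *\<^sub>v v' = k \<cdot>\<^sub>v v'"
    using M' ev by (auto simp: spec_mats_def eigenvector_def)
  have "M *\<^sub>v v = a \<cdot>\<^sub>v (b \<cdot>\<^sub>v (M' *\<^sub>v v'))"
    unfolding a b using c(1,2)
    by (intro eq_vecI) (auto simp: mult_mat_vec_def scalar_prod_def sum_distrib_left ac_simps)
  also have "\<dots> = (a * k) \<cdot>\<^sub>v v"
    unfolding b c(3) by (simp add: smult_smult_assoc ac_simps)
  finally have "eigenvector M v (a * k)"
    using M v by (auto simp: eigenvector_def spec_mats_def)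
  then show "\<exists>k. eigenvector M v k" ..
qed

end

theory Submission
  imports Defs
begin

text \<open>
  Adding \<open>c I\<close> to a matrix moves every eigenvalue by \<open>c\<close> and leaves every eigenvector in place.
  The neighbourhood of \<open>\<langle>M\<rangle>\<close> consists of the lines through the eigenvectors of \<open>M\<close>
  (\<open>neighbours_mat_line\<close>), so it is the same for \<open>M\<close> and \<open>M + c I\<close>
  (\<open>neighbours_mat_line_shift\<close>), and the twin classes agree.

  The class of \<open>\<langle>M\<rangle>\<close> is nontrivial because \<open>\<langle>M + I\<rangle>\<close> lies in it and differs from
  \<open>\<langle>M\<rangle>\<close>: if \<open>M + c I = a M\<close> with \<open>c \<noteq> 0\<close>, then \<open>(a - 1) M = c I\<close>, which for non-scalar \<open>M\<close>
  forces \<open>a = 1\<close> and hence \<open>c I = 0\<close>, impossible in positive dimension.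
\<close>

lemma mat_line_self: "M \<in> mat_line M"
proof -
  have "M = 1 \<cdot>\<^sub>m M" by auto
  then show ?thesis unfolding mat_line_def by blast
qed

lemma eigenvector_shift_iff:
  fixes M :: "'a :: field mat"
  assumes "M \<in> carrier_mat n n"
  shows "eigenvector (M + c \<cdot>\<^sub>m 1\<^sub>m n) v (k + c) \<longleftrightarrow> eigenvector M v k"
proof (cases "v \<in> carrier_vec n")
  case True
  have "(c \<cdot>\<^sub>m 1\<^sub>m n) *\<^sub>v v = c \<cdot>\<^sub>v v"
    using True by (intro eq_vecI) auto
  then have "(M + c \<cdot>\<^sub>m 1\<^sub>m n) *\<^sub>v v = M *\<^sub>v v + c \<cdot>\<^sub>v v"
    using assms True by (simp add: add_mult_distrib_mat_vec[of _ n n])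
  moreover have "(k + c) \<cdot>\<^sub>v v = k \<cdot>\<^sub>v v + c \<cdot>\<^sub>v v"
    by (simp add: add_smult_distrib_vec)
  moreover have "M *\<^sub>v v + c \<cdot>\<^sub>v v = k \<cdot>\<^sub>v v + c \<cdot>\<^sub>v v \<longleftrightarrow> M *\<^sub>v v = k \<cdot>\<^sub>v v"
  proof -
    have "M *\<^sub>v v \<in> carrier_vec n" "k \<cdot>\<^sub>v v \<in> carrier_vec n" "c \<cdot>\<^sub>v v \<in> carrier_vec n"
      using assms True by auto
    then show ?thesis using assms by (auto simp: vec_eq_iff)
  qed
  ultimately show ?thesis
    using assms True by (simp add: eigenvector_def)
next
  case False
  then show ?thesis using assms by (simp add: eigenvector_def)
qed

lemma ex_eigenvector_shift_iff:
  fixes M :: "'a :: field mat"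
  assumes "M \<in> carrier_mat n n"
  shows "(\<exists>k. eigenvector (M + c \<cdot>\<^sub>m 1\<^sub>m n) v k) \<longleftrightarrow> (\<exists>k. eigenvector M v k)"
  using eigenvector_shift_iff[OF assms] by (metis diff_add_cancel)

text \<open>
  Scalar matrices are excluded so that the shift \<open>M + c I\<close> cannot be the zero matrix, which
  spans no vertex of the graph.
\<close>

lemma spec_mats_shift:
  assumes M: "M \<in> spec_mats n" and "\<not> scalar_mat n M"
  shows "M + c \<cdot>\<^sub>m 1\<^sub>m n \<in> spec_mats n"
proof -
  have carrier: "M \<in> carrier_mat n n" using M by (simp add: spec_mats_def)
  have "M + c \<cdot>\<^sub>m 1\<^sub>m n \<noteq> 0\<^sub>m n n"
  proof
    assume "M + c \<cdot>\<^sub>m 1\<^sub>m n = 0\<^sub>m n n"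
    then have "M = (- c) \<cdot>\<^sub>m 1\<^sub>m n"
      using carrier by (auto simp: mat_eq_iff eq_neg_iff_add_eq_0)
    then show False using assms(2) by (auto simp: scalar_mat_def)
  qed
  then show ?thesis
    using M carrier ex_eigenvector_shift_iff[OF carrier, of c] by (auto simp: spec_mats_def)
qed

text \<open>
  Edges join matrix lines to vector lines only, so every neighbour of \<open>\<langle>M\<rangle>\<close> is some \<open>\<langle>v\<rangle>\<close>;
  that \<open>v\<close> itself is an eigenvector of \<open>M\<close> follows because adjacency does not depend on the
  chosen representatives.
\<close>

lemma neighbours_mat_line:
  assumes M: "M \<in> spec_mats n"
  shows "neighbours (SIG n) (Inl (mat_line M)) = {Inr (vec_line v) | v. \<exists>k. eigenvector M v k}"
    (is "?N = ?R")
proof (intro equalityI subsetI)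
  fix y assume y: "y \<in> ?N"
  then have edge: "{Inl (mat_line M), y} \<in> edges (SIG n)"
    by (simp add: neighbours_def)
  then obtain L where "y = Inr L"
    by (auto simp: SIG_def doubleton_eq_iff)
  with y obtain v where "v \<in> carrier_vec n" "v \<noteq> 0\<^sub>v n" "y = Inr (vec_line v)"
    by (auto simp: neighbours_def SIG_def proj_points_def)
  with edge SIG_edge_iff[OF M]
  show "y \<in> ?R" by auto
next
  fix y assume "y \<in> ?R"
  then show "y \<in> ?N"
    using M by (auto simp: neighbours_def SIG_def proj_points_def spec_mats_def eigenvector_def)
qed

lemma neighbours_mat_line_shift:
  assumes "M \<in> spec_mats n" and "\<not> scalar_mat n M"
  shows "neighbours (SIG n) (Inl (mat_line (M + c \<cdot>\<^sub>m 1\<^sub>m n))) = neighbours (SIG n) (Inl (mat_line M))"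
proof -
  have "M \<in> carrier_mat n n" using assms(1) by (simp add: spec_mats_def)
  then show ?thesis
    by (simp add: neighbours_mat_line assms spec_mats_shift ex_eigenvector_shift_iff)
qed

lemma mat_line_shift_neq:
  assumes M: "M \<in> carrier_mat n n" and ns: "\<not> scalar_mat n M" and "n > 0" and "c \<noteq> 0"
  shows "mat_line (M + c \<cdot>\<^sub>m 1\<^sub>m n) \<noteq> mat_line M"
proof
  assume "mat_line (M + c \<cdot>\<^sub>m 1\<^sub>m n) = mat_line M"
  then obtain a where a: "M + c \<cdot>\<^sub>m 1\<^sub>m n = a \<cdot>\<^sub>m M"
    using mat_line_self[of "M + c \<cdot>\<^sub>m 1\<^sub>m n"] by (auto simp: mat_line_def)
  have entry: "(a - 1) * M $$ (i, j) = c * 1\<^sub>m n $$ (i, j)" if "i < n" "j < n" for i j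
    using arg_cong[OF a, of "\<lambda>A. A $$ (i, j)"] M that by (simp add: algebra_simps split: if_splits)
  \<comment> \<open>for \<open>a = 1\<close> the corner entry would give \<open>0 = c\<close>\<close>
  have "a \<noteq> 1" using entry[of 0 0] \<open>n > 0\<close> \<open>c \<noteq> 0\<close> by auto
  then have "M = (c / (a - 1)) \<cdot>\<^sub>m 1\<^sub>m n"
    using M entry by (intro eq_matI) (auto simp: field_simps)
  then show False using ns by (auto simp: scalar_mat_def)
qed

theorem theorem2p7:
  fixes M :: "'a :: {field, finite} mat" and n :: nat
  assumes "n \<ge> 2"
    and "M \<in> spec_mats n"
    and "\<not> scalar_mat n M"
  shows "twin_class (SIG n) (Inl (mat_line M)) \<noteq> {Inl (mat_line M)} \<and>
    (\<forall>c. c \<noteq> 0 \<longrightarrow>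
      twin_class (SIG n) (Inl (mat_line (M + c \<cdot>\<^sub>m 1\<^sub>m n))) = twin_class (SIG n) (Inl (mat_line M)))"
proof (intro conjI allI impI)
  let ?N = "M + 1 \<cdot>\<^sub>m 1\<^sub>m n"
  have "?N \<in> spec_mats n" using assms(2,3) by (rule spec_mats_shift)
  then have "Inl (mat_line ?N) \<in> vertices (SIG n)"
    by (auto simp: SIG_def spec_points_def)
  then have "Inl (mat_line ?N) \<in> twin_class (SIG n) (Inl (mat_line M))"
    using neighbours_mat_line_shift[OF assms(2,3), of 1] by (simp add: twin_class_def)
  moreover have "mat_line ?N \<noteq> mat_line M"
    using assms by (intro mat_line_shift_neq) (auto simp: spec_mats_def)
  ultimately show "twin_class (SIG n) (Inl (mat_line M)) \<noteq> {Inl (mat_line M)}" by auto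
next
  fix c :: 'a
  show "twin_class (SIG n) (Inl (mat_line (M + c \<cdot>\<^sub>m 1\<^sub>m n))) = twin_class (SIG n) (Inl (mat_line M))"
    using neighbours_mat_line_shift[OF assms(2,3)] by (simp add: twin_class_def)
qed

end
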